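(* Finite strategic VC dimension does not necessarily imply PAC learnability with improvements. That is, there exist an instance space $\mathcal{X}$, a concept class $\mathcal{H}\subseteq\{0,1\}^{\mathcal{X}}$ and an improvement function $\Delta:\mathcal{X}\to 2^{\mathcal{X}}$ such that $\mathrm{SVC}(\mathcal{H},\Delta)<\infty$ but $\mathcal{H}$ is not PAC learnable with improvements with respect to $\Delta$.
   Context: Setting. $\mathcal{X}$ is an instance space and labels are in $\{0,1\}$ ($0$ negative, $1$ positive). An improvement function is a map $\Delta:\mathcal{X}\to 2^{\mathcal{X}}$. For a classifier $h:\mathcal{X}\to\{0,1\}$ the reaction set of $x$ is: $\Delta_h(x)=\{x\}$ if $h(x)=1$; $\Delta_h(x)=\{x\}$ if $\{x'\in\Delta(x): h(x')=1\}=\emptyset$; and $\Delta_h(x)=\{x'\in\Delta(x):h(x')=1\}$ otherwise. For a target $f^*:\mathcal{X}\to\{0,1\}$, $\mathrm{Loss}(x;h,f^* )=\max_{x'\in\Delta_h(x)}\mathbb{I}[h(x')\neq f^*(x')]$, and for a distribution $\mathcal{D}$ on $\mathcal{X}$, $\mathrm{Loss}_{\mathcal{D}}(h,f^* )=\mathbb{P}_{x\sim\mathcal{D}}[\mathrm{Loss}(x;h,f^* )=1]$. PAC learning with improvements (realizable). An algorithm PAC-learns $\mathcal{H}$ with improvements with respect to $\Delta$ and $\mathcal{D}$ using sample size $M$ (which may depend on $\epsilon,\delta$) if for any $f^*\in\mathcal{H}$ and $\epsilon,\delta>0$, given $M$ i.i.d. examples from $\mathcal{D}$ labeled by $f^*$,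 it outputs with probability at least $1-\delta$ a hypothesis $h:\mathcal{X}\to\{0,1\}$ (not required to be in $\mathcal{H}$) with $\mathrm{Loss}_{\mathcal{D}}(h,f^* )\le\epsilon$. $\mathcal{H}$ is PAC learnable with improvements with respect to $\Delta$ if there are a finite sample size function $M(\epsilon,\delta)$ and an algorithm achieving this for all distributions $\mathcal{D}$ on $\mathcal{X}$. Strategic VC dimension. The $n$-th shattering coefficient is $$\sigma_n(\mathcal{H},\Delta)=\max_{(x_1,\dots,x_n)\in\mathcal{X}^n}\bigl|\{(h(x_1'),\dots,h(x_n')): h\in\mathcal{H},\ x_i'\in\Delta_h(x_i)\}\bigr|,$$ and $\mathrm{SVC}(\mathcal{H},\Delta)=\sup\{n\ge 0:\sigma_n(\mathcal{H},\Delta)=2^n\}$. *)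

theory Defs
  imports "HOL-Probability.Probability" "HOL-Library.Extended_Nat"
begin

text \<open>
  Labels are Booleans, with \<open>True\<close> for the positive label 1 and \<open>False\<close> for the negative label 0.
  An instance space is a set \<open>X :: 'a set\<close>; a classifier is evaluated only at points of \<open>X\<close>,
  provided that \<open>\<Delta>\<close> maps \<open>X\<close> into the subsets of \<open>X\<close>.
\<close>

definition reaction :: "('a \<Rightarrow> 'a set) \<Rightarrow> ('a \<Rightarrow> bool) \<Rightarrow> 'a \<Rightarrow> 'a set" where
  "reaction \<Delta> h x =
     (if h x \<or> {x' \<in> \<Delta> x. h x'} = {} then {x} else {x' \<in> \<Delta> x. h x'})"

definition improvement_loss ::
  "('a \<Rightarrow> 'a set) \<Rightarrow> ('a \<Rightarrow> bool) \<Rightarrow> ('a \<Rightarrow> bool) \<Rightarrow> 'a \<Rightarrow> nat" where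
  "improvement_loss \<Delta> h f x = Max ((\<lambda>x'. of_bool (h x' \<noteq> f x')) ` reaction \<Delta> h x)"

text \<open>
  Distributions are probability mass functions. Learning is only defined over countable types, where
  these are exactly the probability measures on the discrete \<open>\<sigma>\<close>-algebra, so that neither a
  distribution nor a (non-measurable) hypothesis is excluded.
\<close>

definition distribution_loss ::
  "'a::countable pmf \<Rightarrow> ('a \<Rightarrow> 'a set) \<Rightarrow> ('a \<Rightarrow> bool) \<Rightarrow> ('a \<Rightarrow> bool) \<Rightarrow> real" where
  "distribution_loss D \<Delta> h f = measure_pmf.prob D {x. improvement_loss \<Delta> h f x = 1}"

text \<open>
  A learning algorithm receives \<open>\<epsilon>\<close>, \<open>\<delta>\<close> and a finite labelled sample. It may be randomised, hence
  returns a distribution over hypotheses; deterministic algorithms are the special case of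
  \<^const>\<open>return_pmf\<close>. No computability is demanded.
\<close>

type_synonym 'a learner = "real \<Rightarrow> real \<Rightarrow> ('a \<times> bool) list \<Rightarrow> ('a \<Rightarrow> bool) pmf"

definition labelled_sample :: "nat \<Rightarrow> 'a pmf \<Rightarrow> ('a \<Rightarrow> bool) \<Rightarrow> ('a \<times> bool) list pmf" where
  "labelled_sample m D f = map_pmf (map (\<lambda>x. (x, f x))) (replicate_pmf m D)"

definition PAC_learns_with_improvements ::
  "'a::countable learner \<Rightarrow> (real \<Rightarrow> real \<Rightarrow> nat) \<Rightarrow> ('a \<Rightarrow> bool) set \<Rightarrow> ('a \<Rightarrow> 'a set) \<Rightarrow>
   'a pmf \<Rightarrow> bool" where
  "PAC_learns_with_improvements A M H \<Delta> D \<longleftrightarrow>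
     (\<forall>f\<in>H. \<forall>\<epsilon>>0. \<forall>\<delta>>0.
        measure_pmf.prob (bind_pmf (labelled_sample (M \<epsilon> \<delta>) D f) (A \<epsilon> \<delta>))
          {h. distribution_loss D \<Delta> h f \<le> \<epsilon>} \<ge> 1 - \<delta>)"

definition PAC_learnable_with_improvements ::
  "'a::countable set \<Rightarrow> ('a \<Rightarrow> bool) set \<Rightarrow> ('a \<Rightarrow> 'a set) \<Rightarrow> bool" where
  "PAC_learnable_with_improvements X H \<Delta> \<longleftrightarrow>
     (\<exists>M A. \<forall>D. set_pmf D \<subseteq> X \<longrightarrow> PAC_learns_with_improvements A M H \<Delta> D)"

text \<open>
  Tuples are lists. The maximum ranges over a finite set, as each cardinality is at most \<open>2 ^ n\<close>;
  that set is nonempty unless \<open>X = {}\<close> and \<open>n > 0\<close>.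
\<close>

definition reaction_patterns ::
  "('a \<Rightarrow> bool) set \<Rightarrow> ('a \<Rightarrow> 'a set) \<Rightarrow> 'a list \<Rightarrow> bool list set" where
  "reaction_patterns H \<Delta> xs =
     {map h xs' | h xs'. h \<in> H \<and> list_all2 (\<lambda>x x'. x' \<in> reaction \<Delta> h x) xs xs'}"

definition shattering_coeff ::
  "'a set \<Rightarrow> ('a \<Rightarrow> bool) set \<Rightarrow> ('a \<Rightarrow> 'a set) \<Rightarrow> nat \<Rightarrow> nat" where
  "shattering_coeff X H \<Delta> n =
     Max {card (reaction_patterns H \<Delta> xs) | xs. length xs = n \<and> set xs \<subseteq> X}"

definition SVC :: "'a set \<Rightarrow> ('a \<Rightarrow> bool) set \<Rightarrow> ('a \<Rightarrow> 'a set) \<Rightarrow> enat" where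
  "SVC X H \<Delta> = Sup {enat n | n. shattering_coeff X H \<Delta> n = 2 ^ n}"

end

theory Submission
  imports Defs
begin

text \<open>
  Group the naturals into pairs \<open>{2 i, 2 i + 1}\<close>, let agents move freely within their pair, and take
  all hypotheses that accept exactly one point of each pair. Every agent then ends up accepted, so
  that only the all-positive pattern occurs and the strategic VC dimension is 0. However, on even
  points the improvement loss of an arbitrary hypothesis is its ordinary classification error, and
  the targets restricted to the even points are arbitrary. The classical no-free-lunch averaging
  argument therefore applies: flipping the label of an unseen point leaves the sample unchanged
  and turns correct predictions into errors.
\<close>

lemma labelled_sample_cong:
  assumes "\<And>x. x \<in> set_pmf D \<Longrightarrow> f x = g x"
  shows "labelled_sample m D f = labelled_sample m D g"
  unfolding labelled_sample_def
  by (rule map_pmf_cong) (use assms in \<open>auto simp: set_replicate_pmf\<close>)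

text \<open>Pointwise, \<open>Y\<close> is at most \<open>\<epsilon>\<close> plus the indicator of
  the failure event. This turns a PAC guarantee into a bound on the expected loss, which is the
  quantity that can be averaged over targets.\<close>

lemma expectation_le_of_prob_le:
  fixes Y :: "'a \<Rightarrow> real"
  assumes Y: "\<And>x. 0 \<le> Y x" "\<And>x. Y x \<le> 1"
    and "0 \<le> \<epsilon>" and prob: "measure_pmf.prob p {x. Y x \<le> \<epsilon>} \<ge> 1 - \<delta>"
  shows "measure_pmf.expectation p Y \<le> \<epsilon> + \<delta>"
proof -
  have "measure_pmf.expectation p Y
      \<le> measure_pmf.expectation p (\<lambda>x. \<epsilon> + indicator (- {x. Y x \<le> \<epsilon>}) x)"
  proof (rule integral_mono)
    show "integrable (measure_pmf p) Y"
      by (rule measure_pmf.integrable_const_bound[where B = 1]) (use Y in auto)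
    show "integrable (measure_pmf p) (\<lambda>x. \<epsilon> + indicator (- {x. Y x \<le> \<epsilon>}) x)"
      by (rule measure_pmf.integrable_const_bound[where B = "\<epsilon> + 1"])
        (use \<open>0 \<le> \<epsilon>\<close> in \<open>auto simp: indicator_def\<close>)
  next
    fix x
    show "Y x \<le> \<epsilon> + indicator (- {x. Y x \<le> \<epsilon>}) x"
      using Y[of x] \<open>0 \<le> \<epsilon>\<close> by (auto simp: indicator_def)
  qed
  also have "\<dots> = \<epsilon> + measure_pmf.prob p (- {x. Y x \<le> \<epsilon>})"
    by (subst Bochner_Integration.integral_add)
      (auto intro: measure_pmf.integrable_const_bound[where B = 1])
  also have "\<dots> = \<epsilon> + (1 - measure_pmf.prob p {x. Y x \<le> \<epsilon>})"
    using measure_pmf.prob_compl[of "{x. Y x \<le> \<epsilon>}" p] by (simp add: Compl_eq_Diff_UNIV)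
  finally show ?thesis
    using prob by linarith
qed

text \<open>The identity is transferred from nonnegative integrals, where no integrability is at
  stake; the bounds on \<open>f\<close> keep every integral finite.\<close>

lemma expectation_bind_pmf:
  fixes f :: "'b \<Rightarrow> real"
  assumes f: "\<And>y. 0 \<le> f y" "\<And>y. f y \<le> 1"
  shows "measure_pmf.expectation (bind_pmf p q) f
    = measure_pmf.expectation p (\<lambda>x. measure_pmf.expectation (q x) f)"
proof -
  have nn: "ennreal (measure_pmf.expectation M g) = (\<integral>\<^sup>+y. g y \<partial>measure_pmf M)"
    if "\<And>y. 0 \<le> g y" "\<And>y. g y \<le> 1" for M :: "'c pmf" and g
    by (rule nn_integral_eq_integral[symmetric])
      (use that in \<open>auto intro: measure_pmf.integrable_const_bound[where B = 1]\<close>)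
  have "ennreal (measure_pmf.expectation (bind_pmf p q) f)
      = (\<integral>\<^sup>+x. \<integral>\<^sup>+y. f y \<partial>measure_pmf (q x) \<partial>measure_pmf p)"
    using nn[OF f, of "bind_pmf p q"] by simp
  also have "\<dots> = (\<integral>\<^sup>+x. ennreal (measure_pmf.expectation (q x) f) \<partial>measure_pmf p)"
    by (simp add: nn[OF f])
  also have "\<dots> = ennreal (measure_pmf.expectation p (\<lambda>x. measure_pmf.expectation (q x) f))"
  proof (rule nn[symmetric])
    fix x
    show "0 \<le> measure_pmf.expectation (q x) f"
      using f by simp
    show "measure_pmf.expectation (q x) f \<le> 1"
      by (rule measure_pmf.integral_le_const)
        (use f in \<open>auto intro: measure_pmf.integrable_const_bound[where B = 1]\<close>)
  qed
  finally show ?thesis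
    using f by (subst (asm) ennreal_inj) (auto intro!: integral_nonneg)
qed

text \<open>Toggling membership of \<open>x\<close> in \<open>T\<close> is an involution of
  \<open>Pow W\<close>. It preserves the labels on \<open>S\<close>, hence the learner's output, but
  complements the error event, so the sum equals \<open>2 ^ card W\<close> minus itself.\<close>

lemma sum_error_unseen_point:
  fixes B :: "('a \<times> bool) list \<Rightarrow> ('a \<Rightarrow> bool) pmf"
  assumes "finite W" "x \<in> W" "x \<notin> set S"
  shows "(\<Sum>T\<in>Pow W. measure_pmf.prob (B (map (\<lambda>y. (y, y \<in> T)) S)) {h. h x \<noteq> (x \<in> T)})
    = 2 ^ card W / 2"
proof -
  define g where "g T = measure_pmf.prob (B (map (\<lambda>y. (y, y \<in> T)) S)) {h. h x \<noteq> (x \<in> T)}" for T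
  define flip where "flip T = (if x \<in> T then T - {x} else insert x T)" for T
  have flip: "g (flip T) = 1 - g T" for T
  proof -
    have "map (\<lambda>y. (y, y \<in> flip T)) S = map (\<lambda>y. (y, y \<in> T)) S"
      using assms(3) by (auto simp: flip_def)
    moreover have "{h. h x \<noteq> (x \<in> flip T)} = UNIV - {h. h x \<noteq> (x \<in> T)}"
      by (auto simp: flip_def)
    ultimately show ?thesis
      unfolding g_def by (simp only: measure_pmf.prob_compl[simplified])
  qed
  have "(\<Sum>T\<in>Pow W. g T) = (\<Sum>T\<in>Pow W. g (flip T))"
    by (rule sum.reindex_bij_witness[where i = flip and j = flip])
      (use assms(2) in \<open>auto simp: flip_def insert_absorb\<close>)
  also have "\<dots> = 2 ^ card W - (\<Sum>T\<in>Pow W. g T)"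
    using assms(1) by (simp add: flip sum_subtractf card_Pow)
  finally show ?thesis
    by (simp add: g_def)
qed

text \<open>Averaged over all \<open>T\<close>, each unseen point is misclassified with probability
  1/2, and at least half of \<open>W\<close> is unseen. Some \<open>T\<close> must reach the
  average.\<close>

lemma no_free_lunch:
  fixes B :: "('a \<times> bool) list \<Rightarrow> ('a \<Rightarrow> bool) pmf"
  assumes W: "finite W" "W \<noteq> {}" and m: "2 * m \<le> card W"
  shows "\<exists>T\<subseteq>W. 1 / 4 \<le> measure_pmf.expectation
    (bind_pmf (labelled_sample m (pmf_of_set W) (\<lambda>x. x \<in> T)) B)
    (\<lambda>h. measure_pmf.prob (pmf_of_set W) {x. h x \<noteq> (x \<in> T)})"
proof (rule ccontr)
  define p where "p = replicate_pmf m (pmf_of_set W)"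
  define g where "g S T x =
    measure_pmf.prob (B (map (\<lambda>y. (y, y \<in> T)) S)) {h. h x \<noteq> (x \<in> T)}" for S T x
  define E where "E T = measure_pmf.expectation
    (bind_pmf (labelled_sample m (pmf_of_set W) (\<lambda>x. x \<in> T)) B)
    (\<lambda>h. measure_pmf.prob (pmf_of_set W) {x. h x \<noteq> (x \<in> T)})" for T
  assume "\<not> ?thesis"
  then have small: "E T < 1 / 4" if "T \<in> Pow W" for T
    using that by (auto simp: E_def not_le)
  have cW: "card W > 0"
    using W by (simp add: card_gt_0_iff)
  have fin: "finite (set_pmf p)"
    unfolding p_def set_replicate_pmf using W finite_lists_length_eq[of W m]
    by (auto simp: lists_eq_set elim: rev_finite_subset)
  have int: "integrable (measure_pmf p) f" for f :: "'a list \<Rightarrow> real"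
    by (rule integrable_measure_pmf_finite[OF fin])
  \<comment> \<open>The unlabelled sample \<open>S\<close> has a law independent of
    \<open>T\<close>, so the sum over targets can later be moved inside the expectation.\<close>
  have E_eq: "E T = measure_pmf.expectation p (\<lambda>S. (\<Sum>x\<in>W. g S T x) / card W)" for T
  proof -
    have "E T = measure_pmf.expectation (labelled_sample m (pmf_of_set W) (\<lambda>x. x \<in> T))
      (\<lambda>s. measure_pmf.expectation (B s)
        (\<lambda>h. measure_pmf.prob (pmf_of_set W) {x. h x \<noteq> (x \<in> T)}))"
      unfolding E_def by (rule expectation_bind_pmf) simp_all
    moreover have "measure_pmf.prob (pmf_of_set W) {x. h x \<noteq> (x \<in> T)}
        = (\<Sum>x\<in>W. indicator {h. h x \<noteq> (x \<in> T)} h) / card W" for h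
      using W by (simp add: measure_pmf_of_set indicator_def sum.If_cases Int_def)
    moreover have "measure_pmf.expectation q (\<lambda>h. \<Sum>x\<in>W. indicator {h. h x \<noteq> (x \<in> T)} h)
        = (\<Sum>x\<in>W. measure_pmf.prob q {h. h x \<noteq> (x \<in> T)})" for q :: "('a \<Rightarrow> bool) pmf"
      by (subst Bochner_Integration.integral_sum)
        (auto intro: measure_pmf.integrable_const_bound[where B = 1])
    ultimately show ?thesis
      by (simp add: labelled_sample_def p_def g_def)
  qed
  have "(\<Sum>T\<in>Pow W. E T) < (\<Sum>T\<in>Pow W. 1 / 4)"
    by (rule sum_strict_mono) (use W small in auto)
  also have "\<dots> = 2 ^ card W / 4"
    using W by (simp add: card_Pow)
  also have "\<dots> = measure_pmf.expectation p (\<lambda>S. 2 ^ card W / 4)"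
    by simp
  also have "\<dots> \<le> measure_pmf.expectation p (\<lambda>S. \<Sum>T\<in>Pow W. (\<Sum>x\<in>W. g S T x) / card W)"
  proof (rule integral_mono_AE[OF int int], rule AE_pmfI)
    fix S assume "S \<in> set_pmf p"
    then have "length S = m"
      by (auto simp: p_def set_replicate_pmf)
    then have "card (set S) \<le> m"
      using card_length by blast
    \<comment> \<open>Repetitions in \<open>S\<close> only enlarge the unseen part of
      \<open>W\<close>.\<close>
    then have "card W \<le> 2 * card (W - set S)"
      using m diff_card_le_card_Diff[of "set S" W] by simp
    then have "2 ^ card W / 2 * real (card W) \<le> 2 ^ card W / 2 * real (2 * card (W - set S))"
      by (intro mult_left_mono) auto
    also have "\<dots> = 2 * (\<Sum>x\<in>W - set S. 2 ^ card W / 2)"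
      by simp
    also have "\<dots> = 2 * (\<Sum>x\<in>W - set S. \<Sum>T\<in>Pow W. g S T x)"
      unfolding g_def
      by (intro arg_cong[where f = "(*) 2"] sum.cong refl sum_error_unseen_point[symmetric])
        (use W(1) in auto)
    also have "\<dots> \<le> 2 * (\<Sum>x\<in>W. \<Sum>T\<in>Pow W. g S T x)"
      using W(1) by (intro mult_left_mono sum_mono2 sum_nonneg) (auto simp: g_def)
    also have "\<dots> = 2 * (\<Sum>T\<in>Pow W. \<Sum>x\<in>W. g S T x)"
      by (subst sum.swap) simp
    finally show "2 ^ card W / 4 \<le> (\<Sum>T\<in>Pow W. (\<Sum>x\<in>W. g S T x) / card W)"
      using cW by (simp add: field_simps flip: sum_divide_distrib)
  qed
  also have "\<dots> = (\<Sum>T\<in>Pow W. E T)"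
    by (simp add: E_eq Bochner_Integration.integral_sum int del: integral_divide_zero)
  finally show False
    by simp
qed

definition pair_of :: "nat \<Rightarrow> nat set" where
  "pair_of x = {2 * (x div 2), 2 * (x div 2) + 1}"

definition pair_class :: "(nat \<Rightarrow> bool) set" where
  "pair_class = {h. \<forall>i. h (2 * i + 1) \<longleftrightarrow> \<not> h (2 * i)}"

text \<open>A rejected point always has its accepted partner within reach, so no reaction ends at a
  rejected point.\<close>

lemma reaction_patterns_pair_class:
  "reaction_patterns pair_class pair_of xs = {replicate (length xs) True}"
proof -
  have pos: "h y" if "h \<in> pair_class" "y \<in> reaction pair_of h x" for h x y
    using that by (auto simp: pair_class_def pair_of_def reaction_def split: if_splits)
  have nonempty: "\<exists>y. y \<in> reaction pair_of h x" for h x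
    by (auto simp: reaction_def)
  have "map h ys = replicate (length xs) True"
    if "h \<in> pair_class" "list_all2 (\<lambda>x y. y \<in> reaction pair_of h x) xs ys" for h ys
    using that(2) by induction (auto intro: pos[OF that(1)])
  \<comment> \<open>The witness \<open>even\<close> shows that the all-positive pattern is actually
    attained.\<close>
  moreover have "even \<in> pair_class"
    by (simp add: pair_class_def)
  moreover have "\<exists>ys. list_all2 (\<lambda>x y. y \<in> reaction pair_of even x) xs ys"
  proof (induction xs)
    case (Cons x xs)
    then show ?case
      using nonempty[of even x] by (metis list_all2_Cons)
  qed simp
  ultimately show ?thesis
    unfolding reaction_patterns_def by (safe; force)
qed

lemma SVC_pair_class: "SVC UNIV pair_class pair_of = 0"
proof -
  \<comment> \<open>Tuples of every length exist, so the set under \<open>Max\<close> is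
    \<open>{1}\<close> rather than empty; then \<open>1 = 2 ^ n\<close> forces
    \<open>n = 0\<close>.\<close>
  have "\<exists>xs :: nat list. length xs = n" for n
    by (rule exI[of _ "replicate n 0"]) simp
  then have "shattering_coeff UNIV pair_class pair_of n = 1" for n
    by (simp add: shattering_coeff_def reaction_patterns_pair_class)
  then have "SVC UNIV pair_class pair_of = Sup {0}"
    unfolding SVC_def by (intro arg_cong[where f = Sup]) (auto simp: zero_enat_def power_eq_1_iff dest: sym)
  then show ?thesis
    by simp
qed

text \<open>If \<open>h\<close> rejects an even point but accepts its odd partner, then the agent moves to the partner,
  whose target label is the negation of that of the even point; so the loss is the ordinary
  misclassification loss for every \<open>h\<close>.\<close>

lemma improvement_loss_pair_class:
  assumes "f \<in> pair_class" "even x"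
  shows "improvement_loss pair_of h f x = of_bool (h x \<noteq> f x)"
proof -
  obtain i where i: "x = 2 * i"
    using assms(2) by blast
  have f: "f (Suc (2 * i)) \<longleftrightarrow> \<not> f (2 * i)"
    using assms(1) by (simp add: pair_class_def)
  have "reaction pair_of h x = {if \<not> h x \<and> h (Suc x) then Suc x else x}"
    by (auto simp: reaction_def pair_of_def i)
  then show ?thesis
    using f by (simp add: improvement_loss_def i)
qed

lemma not_PAC_learnable_pair_class:
  "\<not> PAC_learnable_with_improvements UNIV pair_class pair_of"
proof
  assume "PAC_learnable_with_improvements UNIV pair_class pair_of"
  then obtain M A where A: "PAC_learns_with_improvements A M pair_class pair_of D" for D
    unfolding PAC_learnable_with_improvements_def by auto
  \<comment> \<open>With both parameters 1/9 the expected loss would be at most 2/9, which is below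
    1/4.\<close>
  define m where "m = M (1 / 9) (1 / 9)"
  \<comment> \<open>These are \<open>2 * m + 1\<close> even points, so \<open>W\<close> is nonempty
    even when \<open>m = 0\<close>.\<close>
  define W :: "nat set" where "W = (\<lambda>i. 2 * i) ` {..2 * m}"
  define D where "D = pmf_of_set W"
  have W: "finite W" "W \<noteq> {}"
    by (auto simp: W_def)
  have "card W = 2 * m + 1"
    unfolding W_def by (subst card_image) (auto simp: inj_on_def)
  then obtain T where T: "T \<subseteq> W"
    "1 / 4 \<le> measure_pmf.expectation
      (bind_pmf (labelled_sample m D (\<lambda>x. x \<in> T)) (A (1 / 9) (1 / 9)))
      (\<lambda>h. measure_pmf.prob D {x. h x \<noteq> (x \<in> T)})"
    unfolding D_def using no_free_lunch[OF W, of m] by auto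
  \<comment> \<open>The labelling by \<open>T\<close> on even points extends to a target in the
    class by giving each odd point the opposite label of its partner.\<close>
  define f where "f x \<longleftrightarrow> (if even x then x \<in> T else x - 1 \<notin> T)" for x
  have f: "f \<in> pair_class"
    by (simp add: pair_class_def f_def)
  have D: "set_pmf D = W"
    unfolding D_def using W by simp
  then have even: "even x" if "x \<in> set_pmf D" for x
    using that by (auto simp: W_def)
  have sample: "labelled_sample m D (\<lambda>x. x \<in> T) = labelled_sample m D f"
    by (rule labelled_sample_cong) (simp add: even f_def)
  \<comment> \<open>The two events may differ at odd points, but \<open>D\<close> is supported on
    even ones, so almost sure equality suffices.\<close>
  have loss: "distribution_loss D pair_of h f = measure_pmf.prob D {x. h x \<noteq> (x \<in> T)}" for h
    unfolding distribution_loss_def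
    by (rule measure_pmf.finite_measure_eq_AE)
      (auto simp: AE_measure_pmf_iff even improvement_loss_pair_class[OF f] f_def)
  have "measure_pmf.prob (bind_pmf (labelled_sample m D f) (A (1 / 9) (1 / 9)))
      {h. distribution_loss D pair_of h f \<le> 1 / 9} \<ge> 1 - 1 / 9"
    using A[of D, unfolded PAC_learns_with_improvements_def, rule_format, OF f, of "1 / 9" "1 / 9"]
    by (simp add: m_def)
  then have "measure_pmf.expectation (bind_pmf (labelled_sample m D f) (A (1 / 9) (1 / 9)))
      (\<lambda>h. distribution_loss D pair_of h f) \<le> 1 / 9 + 1 / 9"
    by (intro expectation_le_of_prob_le) (auto simp: distribution_loss_def)
  with T(2) show False
    by (simp add: sample loss)
qed

theorem theorem3p4:
  "\<exists>(X :: nat set) (H :: (nat \<Rightarrow> bool) set) (\<Delta> :: nat \<Rightarrow> nat set).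
     X \<noteq> {} \<and> H \<subseteq> X \<rightarrow>\<^sub>E UNIV \<and> \<Delta> \<in> X \<rightarrow> Pow X \<and>
     SVC X H \<Delta> < \<infinity> \<and> \<not> PAC_learnable_with_improvements X H \<Delta>"
  by (rule exI[of _ UNIV], rule exI[of _ pair_class], rule exI[of _ pair_of])
    (simp add: SVC_pair_class not_PAC_learnable_pair_class)

end
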